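(* Let $N\subset L(H^2)$ be the norm-closed subspace generated by $\{S^n:n=0,1,2,\dots\}$, where $S^0=I_{H^2}$ is the identity operator on $H^2$. Then for every operator $X\in\{S_{L(H^2)}\}'$ such that $X(I_{H^2})\in\{S\}'$, there is a function $\theta\in H^\infty$ such that $X=M_{\theta}$ on $N$, i.e. $X(T)=M_\theta T$ for all $T\in N$.
   Context: $\mathbf{D}$ is the open unit disc in $\mathbb{C}$. $H^2$ is the Hardy space of analytic functions $f(z)=\sum_{n\ge 0}a_nz^n$ on $\mathbf{D}$ with $\sum_{n\ge 0}|a_n|^2<\infty$, a Hilbert space with inner product $(f,g)=\sum_n a_n\overline{b_n}$ for $f(z)=\sum a_nz^n$, $g(z)=\sum b_nz^n$. $L(H^2)$ is the Banach space of bounded linear operators on $H^2$ with the operator norm, and $L(L(H^2))$ is the space of bounded linear operators on the Banach space $L(H^2)$. $H^\infty$ is the Banach space of bounded analytic functions on $\mathbf{D}$ with the supremum norm. For $\theta\in H^\infty$, $T_\theta\in L(H^2)$ is given by $(T_\theta f)(z)=\theta(z)f(z)$, and $M_\theta:L(H^2)\to L(H^2)$ is defined by $M_\theta T=T_\theta T$. $S\in L(H^2)$ is the shift $(Sf)(z)=zf(z)$, and $S_{L(H^2)}:L(H^2)\to L(H^2)$ is defined by $S_{L(H^2)}(T)=ST$. The commutants are $\{S\}'=\{T\in L(H^2):ST=TS\}$ and $\{S_{L(H^2)}\}'=\{X\in L(L(H^2)):S_{L(H^2)}X=XS_{L(H^2)}\}$. *)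

theory Defs
  imports "HOL-Complex_Analysis.Complex_Analysis"
begin

section \<open>Complex normed spaces and bounded complex-linear operators\<close>

class complex_normed_vector = real_normed_vector +
  fixes scaleC :: "complex \<Rightarrow> 'a \<Rightarrow> 'a"  (infixr \<open>*\<^sub>C\<close> 75)
  assumes scaleC_add_right: "c *\<^sub>C (x + y) = c *\<^sub>C x + c *\<^sub>C y"
    and scaleC_add_left: "(c + d) *\<^sub>C x = c *\<^sub>C x + d *\<^sub>C x"
    and scaleC_scaleC: "c *\<^sub>C (d *\<^sub>C x) = (c * d) *\<^sub>C x"
    and scaleC_one: "1 *\<^sub>C x = x"
    and scaleC_of_real: "complex_of_real r *\<^sub>C x = r *\<^sub>R x"
    and norm_scaleC: "norm (c *\<^sub>C x) = cmod c * norm x"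

global_interpretation complex_vector:
  vector_space "scaleC :: complex \<Rightarrow> 'a \<Rightarrow> 'a::complex_normed_vector"
  defines cspan_raw_def: cspan = complex_vector.span
  by standard (simp_all add: scaleC_add_right scaleC_add_left scaleC_scaleC scaleC_one)

definition bounded_clinear ::
    "('a::complex_normed_vector \<Rightarrow> 'b::complex_normed_vector) \<Rightarrow> bool" where
  "bounded_clinear f \<longleftrightarrow> bounded_linear f \<and> (\<forall>c x. f (c *\<^sub>C x) = c *\<^sub>C f x)"

lemma bounded_clinearI:
  assumes "\<And>x y. f (x + y) = f x + f y"
    and "\<And>c x. f (c *\<^sub>C x) = c *\<^sub>C f x"
    and "\<And>x. norm (f x) \<le> norm x * K"
  shows "bounded_clinear f"
  unfolding bounded_clinear_def
  using assms(2)[of "complex_of_real _"]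
  by (auto intro!: bounded_linear_intro[where K = K] simp: assms scaleC_of_real)

lemma bounded_clinear_zero: "bounded_clinear (\<lambda>x. 0)"
  by (rule bounded_clinearI[where K = 0]) (simp_all add: complex_vector.scale_zero_right)

lemma bounded_clinear_scaleC: "bounded_clinear f \<Longrightarrow> bounded_clinear (\<lambda>x. c *\<^sub>C f x)"
  unfolding bounded_clinear_def
proof safe
  assume f: "bounded_linear f" "\<forall>c x. f (c *\<^sub>C x) = c *\<^sub>C f x"
  interpret f: bounded_linear f by fact
  obtain K where K: "\<And>x. norm (f x) \<le> norm x * K" using f.bounded by blast
  show "bounded_linear (\<lambda>x. c *\<^sub>C f x)"
  proof (rule bounded_linear_intro[where K = "cmod c * K"])
    fix r x
    show "c *\<^sub>C f (r *\<^sub>R x) = r *\<^sub>R c *\<^sub>C f x"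
      using f(2) by (simp flip: scaleC_of_real add: scaleC_scaleC mult.commute)
  next
    fix x show "norm (c *\<^sub>C f x) \<le> norm x * (cmod c * K)"
      using mult_left_mono[OF K[of x], of "cmod c"] by (simp add: norm_scaleC ac_simps)
  qed (simp add: f.add scaleC_add_right)
qed (simp add: scaleC_scaleC mult.commute)

typedef (overloaded) ('a, 'b) cblinfun =
    "{f :: 'a::complex_normed_vector \<Rightarrow> 'b::complex_normed_vector. bounded_clinear f}"
  morphisms cblinfun_apply CBlinfun
  using bounded_clinear_zero by blast

declare [[coercion "cblinfun_apply :: ('a::complex_normed_vector, 'b::complex_normed_vector) cblinfun \<Rightarrow> 'a \<Rightarrow> 'b"]]

text \<open>The algebra \<open>L(E)\<close> of bounded operators on \<open>E\<close>.\<close>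

type_synonym 'a operators = "('a, 'a) cblinfun"

setup_lifting type_definition_cblinfun

lemma cblinfun_eqI: "(\<And>x. cblinfun_apply A x = cblinfun_apply B x) \<Longrightarrow> A = B"
  by (auto simp flip: cblinfun_apply_inject)

lemma cblinfun_bounded_clinear: "bounded_clinear (cblinfun_apply A)"
  using cblinfun_apply by blast

lemma cblinfun_bounded_linear: "bounded_linear (cblinfun_apply A)"
  using cblinfun_bounded_clinear bounded_clinear_def by blast

lemma cblinfun_scaleC: "cblinfun_apply A (c *\<^sub>C x) = c *\<^sub>C cblinfun_apply A x"
  using cblinfun_bounded_clinear bounded_clinear_def by blast

instantiation cblinfun :: (complex_normed_vector, complex_normed_vector) complex_normed_vector
begin

lift_definition zero_cblinfun :: "('a, 'b) cblinfun" is "\<lambda>x. 0"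
  by (rule bounded_clinear_zero)

lift_definition plus_cblinfun :: "('a, 'b) cblinfun \<Rightarrow> ('a, 'b) cblinfun \<Rightarrow> ('a, 'b) cblinfun"
  is "\<lambda>f g x. f x + g x"
  by (auto simp: bounded_clinear_def scaleC_add_right intro!: bounded_linear_add)

lift_definition uminus_cblinfun :: "('a, 'b) cblinfun \<Rightarrow> ('a, 'b) cblinfun"
  is "\<lambda>f x. - f x"
  by (auto simp: bounded_clinear_def complex_vector.scale_minus_right intro!: bounded_linear_minus)

lift_definition minus_cblinfun :: "('a, 'b) cblinfun \<Rightarrow> ('a, 'b) cblinfun \<Rightarrow> ('a, 'b) cblinfun"
  is "\<lambda>f g x. f x - g x"
  by (auto simp: bounded_clinear_def complex_vector.scale_right_diff_distrib
      intro!: bounded_linear_sub)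

lift_definition scaleC_cblinfun :: "complex \<Rightarrow> ('a, 'b) cblinfun \<Rightarrow> ('a, 'b) cblinfun"
  is "\<lambda>c f x. c *\<^sub>C f x"
  by (rule bounded_clinear_scaleC)

definition scaleR_cblinfun :: "real \<Rightarrow> ('a, 'b) cblinfun \<Rightarrow> ('a, 'b) cblinfun" where
  "scaleR_cblinfun r A = complex_of_real r *\<^sub>C A"

lift_definition norm_cblinfun :: "('a, 'b) cblinfun \<Rightarrow> real" is onorm .

definition sgn_cblinfun :: "('a, 'b) cblinfun \<Rightarrow> ('a, 'b) cblinfun" where
  "sgn_cblinfun A = inverse (norm A) *\<^sub>R A"

definition dist_cblinfun :: "('a, 'b) cblinfun \<Rightarrow> ('a, 'b) cblinfun \<Rightarrow> real" where
  "dist_cblinfun A B = norm (A - B)"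

definition uniformity_cblinfun :: "(('a, 'b) cblinfun \<times> ('a, 'b) cblinfun) filter" where
  "uniformity_cblinfun = (INF e\<in>{0<..}. principal {(A, B). dist A B < e})"

definition open_cblinfun :: "('a, 'b) cblinfun set \<Rightarrow> bool" where
  "open_cblinfun U = (\<forall>A\<in>U. eventually (\<lambda>(A', B). A' = A \<longrightarrow> B \<in> U) uniformity)"

lemma scaleR_cblinfun_apply:
  "cblinfun_apply (r *\<^sub>R A) x = r *\<^sub>R cblinfun_apply A x" for A :: "('a, 'b) cblinfun"
  unfolding scaleR_cblinfun_def by transfer (simp add: scaleC_of_real)

lemma cblinfun_onorm_scaleC:
  assumes f: "bounded_clinear (f :: 'a \<Rightarrow> 'b)"
  shows "onorm (\<lambda>x. c *\<^sub>C f x) = cmod c * onorm f"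
proof -
  have le: "onorm (\<lambda>x. d *\<^sub>C g x) \<le> cmod d * onorm g"
    if "bounded_clinear g" for d and g :: "'a \<Rightarrow> 'b"
  proof (rule onorm_bound)
    have g: "bounded_linear g" using that by (simp add: bounded_clinear_def)
    show "0 \<le> cmod d * onorm g" by (simp add: onorm_pos_le[OF g])
    fix x show "norm (d *\<^sub>C g x) \<le> cmod d * onorm g * norm x"
      using mult_left_mono[OF onorm[OF g, of x], of "cmod d"] by (simp add: norm_scaleC ac_simps)
  qed
  show ?thesis
  proof (cases "c = 0")
    case True
    then show ?thesis by (simp add: complex_vector.scale_zero_left onorm_zero)
  next
    case False
    have "onorm (\<lambda>x. inverse c *\<^sub>C c *\<^sub>C f x) \<le> cmod (inverse c) * onorm (\<lambda>x. c *\<^sub>C f x)"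
      by (rule le[OF bounded_clinear_scaleC[OF f]])
    then have "cmod c * onorm f \<le> onorm (\<lambda>x. c *\<^sub>C f x)"
      using False by (simp add: scaleC_scaleC scaleC_one norm_inverse norm_divide field_simps)
    with le[OF f, of c] show ?thesis by simp
  qed
qed

instance
proof
  fix A B C :: "('a, 'b) cblinfun" and r s :: real and c d :: complex
  show "A + B + C = A + (B + C)" by transfer (simp add: add.assoc)
  show "A + B = B + A" by transfer (simp add: add.commute)
  show "0 + A = A" by transfer simp
  show "- A + A = 0" by transfer simp
  show "A - B = A + - B" by transfer simp
  show c1: "c *\<^sub>C (A + B) = c *\<^sub>C A + c *\<^sub>C B" for c by transfer (simp add: scaleC_add_right)
  show c2: "(c + d) *\<^sub>C A = c *\<^sub>C A + d *\<^sub>C A" for c d by transfer (simp add: scaleC_add_left)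
  show c3: "c *\<^sub>C d *\<^sub>C A = (c * d) *\<^sub>C A" for c d by transfer (simp add: scaleC_scaleC)
  show c4: "1 *\<^sub>C A = A" by transfer (simp add: scaleC_one)
  show "complex_of_real r *\<^sub>C A = r *\<^sub>R A" by (simp add: scaleR_cblinfun_def)
  show "r *\<^sub>R (A + B) = r *\<^sub>R A + r *\<^sub>R B" by (simp add: scaleR_cblinfun_def c1)
  show "(r + s) *\<^sub>R A = r *\<^sub>R A + s *\<^sub>R A" by (simp add: scaleR_cblinfun_def c2)
  show "r *\<^sub>R s *\<^sub>R A = (r * s) *\<^sub>R A" by (simp add: scaleR_cblinfun_def c3)
  show "1 *\<^sub>R A = A" by (simp add: scaleR_cblinfun_def c4)
  show nC: "norm (c *\<^sub>C A) = cmod c * norm A" for c by transfer (rule cblinfun_onorm_scaleC)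
  show "norm (r *\<^sub>R A) = \<bar>r\<bar> * norm A" by (simp add: scaleR_cblinfun_def nC)
  show "norm (A + B) \<le> norm A + norm B"
    by transfer (simp add: bounded_clinear_def onorm_triangle)
  show "norm A = 0 \<longleftrightarrow> A = 0"
    by transfer (auto simp: bounded_clinear_def onorm_eq_0 onorm_zero)
qed (simp_all add: sgn_cblinfun_def dist_cblinfun_def uniformity_cblinfun_def open_cblinfun_def)

end

lift_definition id_operator :: "'a::complex_normed_vector operators" is "\<lambda>x. x"
  by (simp add: bounded_clinear_def bounded_linear_ident)

lift_definition cblinfun_compose ::
    "('b::complex_normed_vector, 'c::complex_normed_vector) cblinfun
      \<Rightarrow> ('a::complex_normed_vector, 'b) cblinfun \<Rightarrow> ('a, 'c) cblinfun"
    (infixl \<open>o\<^sub>C\<close> 55)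
  is "\<lambda>f g x. f (g x)"
  by (auto simp: bounded_clinear_def intro: bounded_linear_compose)

lemma norm_cblinfun_compose: "norm (A o\<^sub>C B) \<le> norm A * norm B"
  by transfer (auto simp: bounded_clinear_def o_def dest: onorm_compose)

definition operator_power :: "'a::complex_normed_vector operators \<Rightarrow> nat \<Rightarrow> 'a operators" where
  "operator_power A n = ((\<lambda>B. A o\<^sub>C B) ^^ n) id_operator"

definition commutant :: "'a::complex_normed_vector operators \<Rightarrow> 'a operators set" where
  "commutant A = {B. A o\<^sub>C B = B o\<^sub>C A}"

definition left_mult ::
    "'a::complex_normed_vector operators \<Rightarrow> 'a operators operators" where
  "left_mult A = CBlinfun (\<lambda>B. A o\<^sub>C B)"

lemma left_mult_apply: "cblinfun_apply (left_mult A) B = A o\<^sub>C B"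
proof -
  have "bounded_clinear (\<lambda>B :: 'a operators. A o\<^sub>C B)"
  proof (rule bounded_clinearI)
    fix B C :: "'a operators" and c :: complex
    show "A o\<^sub>C (B + C) = (A o\<^sub>C B) + (A o\<^sub>C C)"
      by transfer (simp add: bounded_clinear_def linear_simps(1))
    show "A o\<^sub>C (c *\<^sub>C B) = c *\<^sub>C (A o\<^sub>C B)"
      by transfer (simp add: bounded_clinear_def)
    show "norm (A o\<^sub>C B) \<le> norm B * norm A"
      using norm_cblinfun_compose[of A B] by (simp add: mult.commute)
  qed
  then show ?thesis by (simp add: left_mult_def CBlinfun_inverse)
qed

section \<open>The Hardy space\<close>

definition taylor_coeff :: "(complex \<Rightarrow> complex) \<Rightarrow> nat \<Rightarrow> complex" where
  "taylor_coeff f n = (deriv ^^ n) f 0 / fact n"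

lemma taylor_coeff_sums:
  assumes "f holomorphic_on ball 0 1" "z \<in> ball 0 1"
  shows "(\<lambda>n. taylor_coeff f n * z ^ n) sums f z"
  using holomorphic_power_series[OF assms] by (simp add: taylor_coeff_def)

lemma taylor_coeff_cong:
  assumes "\<And>z. z \<in> ball 0 1 \<Longrightarrow> f z = g z"
  shows "taylor_coeff f n = taylor_coeff g n"
proof -
  have "eventually (\<lambda>z. f z = g z) (nhds 0)"
    using assms by (intro eventually_nhds[THEN iffD2] exI[of _ "ball 0 1"]) auto
  then show ?thesis
    unfolding taylor_coeff_def by (simp add: higher_deriv_cong_ev)
qed

lemma taylor_coeff_zero: "taylor_coeff (\<lambda>z. 0) n = 0"
  by (cases n) (simp_all add: taylor_coeff_def)

lemma taylor_coeff_add: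
  assumes "f holomorphic_on ball 0 1" "g holomorphic_on ball 0 1"
  shows "taylor_coeff (\<lambda>z. f z + g z) n = taylor_coeff f n + taylor_coeff g n"
  unfolding taylor_coeff_def
  by (subst higher_deriv_add[OF assms]) (simp_all add: add_divide_distrib)

lemma taylor_coeff_cmult:
  assumes "f holomorphic_on ball 0 1"
  shows "taylor_coeff (\<lambda>z. c * f z) n = c * taylor_coeff f n"
  unfolding taylor_coeff_def
  by (subst higher_deriv_cmult[where A = "ball 0 1"]) (simp_all add: assms)

lemma power2_norm_add_le: "(cmod (a + b))\<^sup>2 \<le> 2 * (cmod a)\<^sup>2 + 2 * (cmod b)\<^sup>2"
proof -
  have "(cmod (a + b))\<^sup>2 \<le> (cmod a + cmod b)\<^sup>2"
    by (intro power_mono norm_triangle_ineq) simp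
  also have "\<dots> \<le> 2 * (cmod a)\<^sup>2 + 2 * (cmod b)\<^sup>2"
    using sum_squares_bound[of "cmod a" "cmod b"] by (simp add: power2_sum)
  finally show ?thesis .
qed

text \<open>
  Functions on the disc are represented by total functions that vanish outside it, so that
  equality in the type is equality on the disc.
\<close>

typedef hardy =
    "{f :: complex \<Rightarrow> complex. f holomorphic_on ball 0 1 \<and> (\<forall>z. z \<notin> ball 0 1 \<longrightarrow> f z = 0) \<and>
       summable (\<lambda>n. (cmod (taylor_coeff f n))\<^sup>2)}"
  morphisms hardy_apply Hardy
  by (rule exI[of _ "\<lambda>z. 0"]) (simp add: taylor_coeff_zero)

declare [[coercion hardy_apply]]

setup_lifting type_definition_hardy

definition hardy_coeff :: "hardy \<Rightarrow> nat \<Rightarrow> complex" where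
  "hardy_coeff f = taylor_coeff (hardy_apply f)"

definition hardy_inner :: "hardy \<Rightarrow> hardy \<Rightarrow> complex" where
  "hardy_inner f g = (\<Sum>n. hardy_coeff f n * cnj (hardy_coeff g n))"

lemma hardy_holomorphic: "hardy_apply f holomorphic_on ball 0 1"
  using hardy_apply[of f] by simp

lemma hardy_outside: "z \<notin> ball 0 1 \<Longrightarrow> hardy_apply f z = 0"
  using hardy_apply[of f] by blast

lemma hardy_summable: "summable (\<lambda>n. (cmod (hardy_coeff f n))\<^sup>2)"
  using hardy_apply[of f] by (simp add: hardy_coeff_def)

lemma hardy_sums: "z \<in> ball 0 1 \<Longrightarrow> (\<lambda>n. hardy_coeff f n * z ^ n) sums hardy_apply f z"
  unfolding hardy_coeff_def by (rule taylor_coeff_sums[OF hardy_holomorphic])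

lemma hardy_eqI: "(\<And>z. z \<in> ball 0 1 \<Longrightarrow> hardy_apply f z = hardy_apply g z) \<Longrightarrow> f = g"
  using hardy_outside by (metis (no_types) ext hardy_apply_inject)

lemma hardy_eqI_coeff: "(\<And>n. hardy_coeff f n = hardy_coeff g n) \<Longrightarrow> f = g"
  using hardy_sums by (intro hardy_eqI) (metis (no_types, lifting) ext sums_unique2)

lemma hardy_inner_summable: "summable (\<lambda>n. hardy_coeff f n * cnj (hardy_coeff g n))"
proof (rule summable_comparison_test')
  show "summable (\<lambda>n. (cmod (hardy_coeff f n))\<^sup>2 + (cmod (hardy_coeff g n))\<^sup>2)"
    by (intro summable_add hardy_summable)
  fix n
  have "2 * cmod (hardy_coeff f n) * cmod (hardy_coeff g n)
      \<le> (cmod (hardy_coeff f n))\<^sup>2 + (cmod (hardy_coeff g n))\<^sup>2"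
    by (rule sum_squares_bound)
  moreover have "0 \<le> cmod (hardy_coeff f n) * cmod (hardy_coeff g n)" by simp
  ultimately show "norm (hardy_coeff f n * cnj (hardy_coeff g n))
      \<le> (cmod (hardy_coeff f n))\<^sup>2 + (cmod (hardy_coeff g n))\<^sup>2"
    unfolding norm_mult complex_mod_cnj by linarith
qed

instantiation hardy :: real_inner
begin

lift_definition zero_hardy :: hardy is "\<lambda>z. 0"
  by (simp add: taylor_coeff_zero)

lift_definition plus_hardy :: "hardy \<Rightarrow> hardy \<Rightarrow> hardy" is "\<lambda>f g z. f z + g z"
proof clarsimp
  fix f g :: "complex \<Rightarrow> complex"
  assume fg: "f holomorphic_on ball 0 1" "g holomorphic_on ball 0 1"
    "summable (\<lambda>n. (cmod (taylor_coeff f n))\<^sup>2)" "summable (\<lambda>n. (cmod (taylor_coeff g n))\<^sup>2)"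
  have "summable (\<lambda>n. (cmod (taylor_coeff (\<lambda>z. f z + g z) n))\<^sup>2)"
  proof (rule summable_comparison_test')
    show "summable (\<lambda>n. 2 * (cmod (taylor_coeff f n))\<^sup>2 + 2 * (cmod (taylor_coeff g n))\<^sup>2)"
      by (intro summable_add summable_mult fg)
  qed (simp add: taylor_coeff_add fg power2_norm_add_le)
  then show "(\<lambda>z. f z + g z) holomorphic_on ball 0 1 \<and>
      summable (\<lambda>n. (cmod (taylor_coeff (\<lambda>z. f z + g z) n))\<^sup>2)"
    by (simp add: fg holomorphic_on_add)
qed

lift_definition scale_hardy :: "complex \<Rightarrow> hardy \<Rightarrow> hardy" is "\<lambda>c f z. c * f z"
  by (auto simp: taylor_coeff_cmult norm_mult power_mult_distrib
      intro!: holomorphic_intros summable_mult)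

definition uminus_hardy :: "hardy \<Rightarrow> hardy" where
  "uminus_hardy f = scale_hardy (- 1) f"

definition minus_hardy :: "hardy \<Rightarrow> hardy \<Rightarrow> hardy" where
  "minus_hardy f g = f + - g"

definition scaleR_hardy :: "real \<Rightarrow> hardy \<Rightarrow> hardy" where
  "scaleR_hardy r f = scale_hardy (complex_of_real r) f"

text \<open>The underlying real inner product; it induces the same norm as the complex one.\<close>

definition inner_hardy :: "hardy \<Rightarrow> hardy \<Rightarrow> real" where
  "inner_hardy f g = Re (hardy_inner f g)"

definition norm_hardy :: "hardy \<Rightarrow> real" where
  "norm_hardy f = sqrt (inner f f)"

definition sgn_hardy :: "hardy \<Rightarrow> hardy" where
  "sgn_hardy f = inverse (norm f) *\<^sub>R f"

definition dist_hardy :: "hardy \<Rightarrow> hardy \<Rightarrow> real" where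
  "dist_hardy f g = norm (f - g)"

definition uniformity_hardy :: "(hardy \<times> hardy) filter" where
  "uniformity_hardy = (INF e\<in>{0<..}. principal {(f, g). dist f g < e})"

definition open_hardy :: "hardy set \<Rightarrow> bool" where
  "open_hardy U = (\<forall>f\<in>U. eventually (\<lambda>(f', g). f' = f \<longrightarrow> g \<in> U) uniformity)"

lemma hardy_coeff_zero: "hardy_coeff 0 n = 0"
  by (simp add: hardy_coeff_def zero_hardy.rep_eq taylor_coeff_zero)

lemma hardy_coeff_add: "hardy_coeff (f + g) n = hardy_coeff f n + hardy_coeff g n"
  by (simp add: hardy_coeff_def plus_hardy.rep_eq taylor_coeff_add hardy_holomorphic)

lemma hardy_coeff_scale: "hardy_coeff (scale_hardy c f) n = c * hardy_coeff f n"
  by (simp add: hardy_coeff_def scale_hardy.rep_eq taylor_coeff_cmult hardy_holomorphic)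

lemma hardy_inner_self: "hardy_inner f f = complex_of_real (\<Sum>n. (cmod (hardy_coeff f n))\<^sup>2)"
  unfolding hardy_inner_def
  by (subst suminf_of_real[OF hardy_summable]) (simp only: complex_norm_square)

instance
proof
  fix f g h :: hardy and r s :: real
  show "f + g + h = f + (g + h)" by (rule hardy_eqI) (simp add: plus_hardy.rep_eq)
  show "f + g = g + f" by (rule hardy_eqI) (simp add: plus_hardy.rep_eq)
  show "0 + f = f" by (rule hardy_eqI) (simp add: plus_hardy.rep_eq zero_hardy.rep_eq)
  show "- f + f = 0"
    by (rule hardy_eqI)
      (simp add: plus_hardy.rep_eq zero_hardy.rep_eq uminus_hardy_def scale_hardy.rep_eq)
  show "f - g = f + - g" by (simp add: minus_hardy_def)
  show "r *\<^sub>R (f + g) = r *\<^sub>R f + r *\<^sub>R g"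
    by (rule hardy_eqI)
      (simp add: plus_hardy.rep_eq scaleR_hardy_def scale_hardy.rep_eq distrib_left)
  show "(r + s) *\<^sub>R f = r *\<^sub>R f + s *\<^sub>R f"
    by (rule hardy_eqI)
      (simp add: plus_hardy.rep_eq scaleR_hardy_def scale_hardy.rep_eq distrib_right)
  show "r *\<^sub>R s *\<^sub>R f = (r * s) *\<^sub>R f"
    by (rule hardy_eqI) (simp add: scaleR_hardy_def scale_hardy.rep_eq)
  show "1 *\<^sub>R f = f"
    by (rule hardy_eqI) (simp add: scaleR_hardy_def scale_hardy.rep_eq)
  have re: "inner f g = (\<Sum>n. Re (hardy_coeff f n * cnj (hardy_coeff g n)))" for f g
    unfolding inner_hardy_def hardy_inner_def by (rule Re_suminf[OF hardy_inner_summable])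
  have sre: "summable (\<lambda>n. Re (hardy_coeff f n * cnj (hardy_coeff g n)))" for f g
    by (rule summable_Re[OF hardy_inner_summable])
  have self: "inner f f = (\<Sum>n. (cmod (hardy_coeff f n))\<^sup>2)"
    by (simp add: inner_hardy_def hardy_inner_self)
  show "inner f g = inner g f" unfolding re by (simp add: mult.commute)
  show "inner (f + g) h = inner f h + inner g h"
    unfolding re by (subst suminf_add[OF sre sre]) (simp add: hardy_coeff_add algebra_simps)
  show "inner (r *\<^sub>R f) g = r * inner f g"
    unfolding re
    by (subst suminf_mult[OF sre, symmetric])
      (simp add: scaleR_hardy_def hardy_coeff_scale algebra_simps)
  show "0 \<le> inner f f" unfolding self by (intro suminf_nonneg hardy_summable) simp
  show "inner f f = 0 \<longleftrightarrow> f = 0"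
  proof
    assume "inner f f = 0"
    then have "hardy_coeff f n = 0" for n
      unfolding self using suminf_eq_zero_iff[OF hardy_summable[of f]] by simp
    then show "f = 0" by (intro hardy_eqI_coeff) (simp add: hardy_coeff_zero)
  next
    assume "f = 0"
    then show "inner f f = 0" unfolding self by (simp add: hardy_coeff_zero)
  qed
qed (simp_all add: norm_hardy_def sgn_hardy_def dist_hardy_def uniformity_hardy_def
    open_hardy_def)

end

lemma norm_hardy_square: "(norm f)\<^sup>2 = (\<Sum>n. (cmod (hardy_coeff f n))\<^sup>2)"
  unfolding power2_norm_eq_inner[where x = f] by (simp add: inner_hardy_def hardy_inner_self)

instantiation hardy :: complex_normed_vector
begin

definition scaleC_hardy :: "complex \<Rightarrow> hardy \<Rightarrow> hardy" where
  "scaleC_hardy = scale_hardy"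

instance
proof
  fix f g :: hardy and c d :: complex and r :: real
  show "c *\<^sub>C (f + g) = c *\<^sub>C f + c *\<^sub>C g"
    by (rule hardy_eqI)
      (simp add: plus_hardy.rep_eq scaleC_hardy_def scale_hardy.rep_eq distrib_left)
  show "(c + d) *\<^sub>C f = c *\<^sub>C f + d *\<^sub>C f"
    by (rule hardy_eqI)
      (simp add: plus_hardy.rep_eq scaleC_hardy_def scale_hardy.rep_eq distrib_right)
  show "c *\<^sub>C d *\<^sub>C f = (c * d) *\<^sub>C f"
    by (rule hardy_eqI) (simp add: scaleC_hardy_def scale_hardy.rep_eq)
  show "1 *\<^sub>C f = f"
    by (rule hardy_eqI) (simp add: scaleC_hardy_def scale_hardy.rep_eq)
  show "complex_of_real r *\<^sub>C f = r *\<^sub>R f"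
    by (simp add: scaleC_hardy_def scaleR_hardy_def)
  have "(norm (c *\<^sub>C f))\<^sup>2 = (cmod c * norm f)\<^sup>2"
    unfolding norm_hardy_square power_mult_distrib
    by (subst suminf_mult[OF hardy_summable, symmetric])
      (simp add: scaleC_hardy_def hardy_coeff_scale norm_mult power_mult_distrib)
  then show "norm (c *\<^sub>C f) = cmod c * norm f"
    by (simp add: power2_eq_iff_nonneg)
qed

end

section \<open>Multiplication operators\<close>

definition Hinf :: "(complex \<Rightarrow> complex) set" where
  "Hinf = {\<theta>. \<theta> holomorphic_on ball 0 1 \<and> bounded (\<theta> ` ball 0 1)}"

text \<open>
  The next lemmas show that multiplication by a bounded analytic function is a bounded operator.
  They replace Parseval's formula on circles of radius \<open>r < 1\<close> by its discrete version
  for the \<open>N\<close>-th roots of unity.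
\<close>

lemma sum_roots_of_unity:
  assumes "n < N" "m < N"
  shows "(\<Sum>k<N. cis (2 * pi * real k / N) ^ n * cnj (cis (2 * pi * real k / N) ^ m))
      = (if n = m then of_nat N else 0)"
proof -
  define w where "w = cis (2 * pi * (real n - real m) / N)"
  have "cis (2 * pi * real k / N) ^ n * cnj (cis (2 * pi * real k / N) ^ m) = w ^ k" for k
    unfolding w_def Complex.DeMoivre cis_cnj cis_mult
    by (rule arg_cong[where f = cis]) (simp add: diff_divide_distrib algebra_simps)
  then have *: "(\<Sum>k<N. cis (2 * pi * real k / N) ^ n * cnj (cis (2 * pi * real k / N) ^ m))
      = (\<Sum>k<N. w ^ k)" by simp
  show ?thesis
  proof (cases "n = m")
    case True
    then show ?thesis unfolding * by (simp add: w_def)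
  next
    case False
    have N: "N > 0" using assms by simp
    have "w ^ N = cis (2 * pi * of_int (int n - int m))"
      using N by (simp add: w_def Complex.DeMoivre)
    also have "\<dots> = 1" by (rule cis_multiple_2pi) simp
    finally have wN: "w ^ N = 1" .
    have "w \<noteq> 1"
    proof
      assume "w = 1"
      then have "cos (2 * pi * (real n - real m) / N) = 1"
        by (simp add: w_def complex_eq_iff)
      then obtain j :: int where "2 * pi * (real n - real m) / N = of_int j * 2 * pi"
        by (auto simp: cos_one_2pi_int)
      then have "2 * pi * (real n - real m) = 2 * pi * (of_int j * real N)"
        using N by (simp add: field_simps)
      then have "real n - real m = of_int j * real N" by (simp only: mult_cancel_left) simp
      then have "real_of_int (int n - int m) = real_of_int (j * int N)" by simp
      then have "int n - int m = j * int N" by (simp only: of_int_eq_iff)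
      moreover from this False have "1 \<le> \<bar>j\<bar>" by (cases "j = 0") auto
      ultimately have "int N \<le> \<bar>int n - int m\<bar>"
        by (simp add: abs_mult mult_le_cancel_right1)
      then show False using assms by linarith
    qed
    then show ?thesis unfolding * using False wN by (simp add: sum_gp_strict geometric_sum)
  qed
qed

lemma discrete_parseval:
  fixes b :: "nat \<Rightarrow> complex"
  shows "(\<Sum>k<N. (cmod (\<Sum>n<N. b n * cis (2 * pi * real k / N) ^ n))\<^sup>2)
      = N * (\<Sum>n<N. (cmod (b n))\<^sup>2)"
proof -
  let ?w = "\<lambda>k::nat. cis (2 * pi * k / N)"
  have "complex_of_real (\<Sum>k<N. (cmod (\<Sum>n<N. b n * ?w k ^ n))\<^sup>2)
      = (\<Sum>k<N. (\<Sum>n<N. b n * ?w k ^ n) * cnj (\<Sum>n<N. b n * ?w k ^ n))"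
    by (simp only: of_real_sum complex_norm_square)
  also have "\<dots> = (\<Sum>k<N. \<Sum>n<N. \<Sum>m<N. b n * cnj (b m) * (?w k ^ n * cnj (?w k ^ m)))"
    unfolding cnj_sum sum_product by (intro sum.cong refl) (simp add: ac_simps)
  also have "\<dots> = (\<Sum>n<N. \<Sum>k<N. \<Sum>m<N. b n * cnj (b m) * (?w k ^ n * cnj (?w k ^ m)))"
    by (rule sum.swap)
  also have "\<dots> = (\<Sum>n<N. \<Sum>m<N. \<Sum>k<N. b n * cnj (b m) * (?w k ^ n * cnj (?w k ^ m)))"
    by (rule sum.cong[OF refl sum.swap])
  also have "\<dots> = (\<Sum>n<N. \<Sum>m<N. b n * cnj (b m) * (if n = m then of_nat N else 0))"
    unfolding sum_distrib_left[symmetric]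
    by (intro sum.cong refl arg_cong2[where f = "(*)"]) (simp only: sum_roots_of_unity lessThan_iff)
  also have "\<dots> = (\<Sum>n<N. b n * cnj (b n) * of_nat N)"
    by (intro sum.cong refl) (simp add: if_distrib cong: if_cong)
  also have "\<dots> = complex_of_real (N * (\<Sum>n<N. (cmod (b n))\<^sup>2))"
    by (simp add: complex_norm_square[symmetric] sum_distrib_left mult.commute)
  finally show ?thesis by (simp only: of_real_eq_iff)
qed

lemma taylor_uniform_approx:
  assumes "f holomorphic_on ball 0 1" "0 < r" "r < 1" "0 < e"
  shows "\<forall>\<^sub>F N in sequentially. \<forall>z\<in>cball 0 r. cmod ((\<Sum>n<N. taylor_coeff f n * z ^ n) - f z) < e"
proof -
  have "ereal r < conv_radius (taylor_coeff f)"
  proof -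
    define s where "s = (r + 1) / 2"
    have s: "r < s" "s < 1" "0 < s" using assms by (auto simp: s_def)
    have "summable (\<lambda>n. taylor_coeff f n * complex_of_real s ^ n)"
      using taylor_coeff_sums[OF assms(1), of "complex_of_real s"] s by (simp add: sums_iff)
    then have "ereal (norm (complex_of_real s)) \<le> conv_radius (taylor_coeff f)"
      by (rule conv_radius_geI)
    then show ?thesis using s
      by (metis abs_of_pos ereal_less(2) ereal_less_eq(3) less_le_trans norm_of_real
          less_ereal.simps(1))
  qed
  then have "uniform_limit (cball 0 r) (\<lambda>n x. \<Sum>i<n. taylor_coeff f i * (x - 0) ^ i)
      (\<lambda>x. \<Sum>i. taylor_coeff f i * (x - 0) ^ i) sequentially"
    by (rule powser_uniform_limit)
  then have "\<forall>\<^sub>F N in sequentially. \<forall>z\<in>cball 0 r.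
      dist (\<Sum>n<N. taylor_coeff f n * (z - 0) ^ n) (\<Sum>n. taylor_coeff f n * (z - 0) ^ n) < e"
    using assms(4) by (rule uniform_limitD)
  then show ?thesis
  proof (rule eventually_mono, intro ballI)
    fix N and z :: complex
    assume *: "\<forall>z\<in>cball 0 r. dist (\<Sum>n<N. taylor_coeff f n * (z - 0) ^ n)
        (\<Sum>n. taylor_coeff f n * (z - 0) ^ n) < e" and z: "z \<in> cball 0 r"
    have "(\<Sum>n. taylor_coeff f n * z ^ n) = f z"
      using taylor_coeff_sums[OF assms(1), of z] z assms by (simp add: sums_iff)
    then show "cmod ((\<Sum>n<N. taylor_coeff f n * z ^ n) - f z) < e"
      using *[rule_format, OF z] by (simp add: dist_norm)
  qed
qed

lemma taylor_square_sum_mult_le: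
  assumes f: "f holomorphic_on ball 0 1" and g: "g holomorphic_on ball 0 1"
    and A: "summable (\<lambda>n. (cmod (taylor_coeff f n))\<^sup>2)"
    and M: "\<And>z. z \<in> ball 0 1 \<Longrightarrow> cmod (g z) \<le> M * cmod (f z)" "0 \<le> M"
  shows "(\<Sum>n<K. (cmod (taylor_coeff g n))\<^sup>2) \<le> M\<^sup>2 * (\<Sum>n. (cmod (taylor_coeff f n))\<^sup>2)"
proof -
  define a c where "a = taylor_coeff f" and "c = taylor_coeff g"
  define S where "S = (\<Sum>n. (cmod (a n))\<^sup>2)"
  have S: "summable (\<lambda>n. (cmod (a n))\<^sup>2)" using A by (simp add: a_def)
  have S0: "0 \<le> S" unfolding S_def by (intro suminf_nonneg S) simp
  have approx: "sqrt (\<Sum>n<K. (cmod (c n))\<^sup>2 * (r ^ n)\<^sup>2) \<le> M * sqrt S + (M + 1) * e"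
    if r: "0 < r" "r < 1" and e: "0 < e" for r e :: real
  proof -
    have "\<forall>\<^sub>F N in sequentially.
        (\<forall>z\<in>cball 0 r. cmod ((\<Sum>n<N. a n * z ^ n) - f z) < e) \<and>
        (\<forall>z\<in>cball 0 r. cmod ((\<Sum>n<N. c n * z ^ n) - g z) < e) \<and> Suc K \<le> N"
      unfolding a_def c_def
      by (intro eventually_conj taylor_uniform_approx f g r e eventually_ge_at_top)
    then obtain N where N: "\<And>z. z \<in> cball 0 r \<Longrightarrow> cmod ((\<Sum>n<N. a n * z ^ n) - f z) < e"
      "\<And>z. z \<in> cball 0 r \<Longrightarrow> cmod ((\<Sum>n<N. c n * z ^ n) - g z) < e" "Suc K \<le> N"
      using eventually_happens'[OF sequentially_bot] by blast
    define z where "z k = complex_of_real r * cis (2 * pi * real k / N)" for k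
    have zr: "z k \<in> cball 0 r" for k using r by (simp add: z_def norm_mult)
    have z1: "z k \<in> ball 0 1" for k using zr[of k] r by simp
    let ?L = "\<lambda>u. L2_set (\<lambda>k. cmod (u k)) {..<N}"
    have tri: "?L u \<le> ?L v + ?L (\<lambda>k. u k - v k)" for u v :: "nat \<Rightarrow> complex"
    proof -
      have "?L u \<le> L2_set (\<lambda>k. cmod (v k) + cmod (u k - v k)) {..<N}"
        by (rule L2_set_mono) (simp_all add: norm_triangle_sub)
      also have "\<dots> \<le> ?L v + ?L (\<lambda>k. u k - v k)" by (rule L2_set_triangle_ineq)
      finally show ?thesis .
    qed
    have small: "?L u \<le> sqrt N * e" if "\<And>k. cmod (u k) < e" for u :: "nat \<Rightarrow> complex"
    proof -
      have "?L u \<le> L2_set (\<lambda>k. e) {..<N}"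
        by (rule L2_set_mono) (simp_all add: less_imp_le that)
      also have "\<dots> = sqrt N * e" using e by (simp add: L2_set_constant)
      finally show ?thesis .
    qed
    have pars: "?L (\<lambda>k. \<Sum>n<N. b n * z k ^ n)
        = sqrt N * sqrt (\<Sum>n<N. (cmod (b n))\<^sup>2 * (r ^ n)\<^sup>2)" for b
    proof -
      have "(\<Sum>n<N. b n * z k ^ n) = (\<Sum>n<N. (b n * of_real r ^ n) * cis (2 * pi * k / N) ^ n)"
        for k by (simp add: z_def power_mult_distrib mult.assoc)
      then have "?L (\<lambda>k. \<Sum>n<N. b n * z k ^ n)
          = sqrt (N * (\<Sum>n<N. (cmod (b n * of_real r ^ n))\<^sup>2))"
        unfolding L2_set_def by (simp only: discrete_parseval)
      also have "\<dots> = sqrt N * sqrt (\<Sum>n<N. (cmod (b n))\<^sup>2 * (r ^ n)\<^sup>2)"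
        using r by (simp add: real_sqrt_mult norm_mult norm_power power_mult_distrib)
      finally show ?thesis .
    qed
    have "sqrt N * sqrt (\<Sum>n<N. (cmod (c n))\<^sup>2 * (r ^ n)\<^sup>2) = ?L (\<lambda>k. \<Sum>n<N. c n * z k ^ n)"
      by (simp only: pars)
    also have "\<dots> \<le> ?L (\<lambda>k. g (z k)) + ?L (\<lambda>k. (\<Sum>n<N. c n * z k ^ n) - g (z k))"
      by (rule tri)
    also have "?L (\<lambda>k. (\<Sum>n<N. c n * z k ^ n) - g (z k)) \<le> sqrt N * e"
      by (rule small) (rule N(2)[OF zr])
    also have "?L (\<lambda>k. g (z k)) \<le> L2_set (\<lambda>k. M * cmod (f (z k))) {..<N}"
      by (rule L2_set_mono) (simp_all add: M(1)[OF z1])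
    also have "\<dots> = M * ?L (\<lambda>k. f (z k))"
      by (simp add: L2_set_right_distrib M(2))
    also have "?L (\<lambda>k. f (z k))
        \<le> ?L (\<lambda>k. \<Sum>n<N. a n * z k ^ n) + ?L (\<lambda>k. f (z k) - (\<Sum>n<N. a n * z k ^ n))"
      by (rule tri)
    also have "?L (\<lambda>k. f (z k) - (\<Sum>n<N. a n * z k ^ n)) \<le> sqrt N * e"
      by (rule small) (metis N(1)[OF zr] norm_minus_commute)
    also have "?L (\<lambda>k. \<Sum>n<N. a n * z k ^ n) \<le> sqrt N * sqrt S"
      unfolding pars
    proof (intro mult_left_mono real_sqrt_le_mono)
      have "(\<Sum>n<N. (cmod (a n))\<^sup>2 * (r ^ n)\<^sup>2) \<le> (\<Sum>n<N. (cmod (a n))\<^sup>2)"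
        using r by (intro sum_mono mult_right_le_one_le) (simp_all add: power_le_one)
      also have "\<dots> \<le> S" unfolding S_def by (rule sum_le_suminf[OF S]) auto
      finally show "(\<Sum>n<N. (cmod (a n))\<^sup>2 * (r ^ n)\<^sup>2) \<le> S" .
    qed simp
    finally have "sqrt N * sqrt (\<Sum>n<N. (cmod (c n))\<^sup>2 * (r ^ n)\<^sup>2)
        \<le> M * (sqrt N * sqrt S + sqrt N * e) + sqrt N * e"
      using M(2) by (simp add: mult_left_mono)
    also have "\<dots> = sqrt N * (M * sqrt S + (M + 1) * e)" by (simp add: algebra_simps)
    finally have "sqrt (\<Sum>n<N. (cmod (c n))\<^sup>2 * (r ^ n)\<^sup>2) \<le> M * sqrt S + (M + 1) * e"
      using N(3) by simp
    moreover have "(\<Sum>n<K. (cmod (c n))\<^sup>2 * (r ^ n)\<^sup>2) \<le> (\<Sum>n<N. (cmod (c n))\<^sup>2 * (r ^ n)\<^sup>2)"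
      using N(3) by (intro sum_mono2) auto
    ultimately show ?thesis by (meson order_trans real_sqrt_le_mono)
  qed
  have bound_r: "sqrt (\<Sum>n<K. (cmod (c n))\<^sup>2 * (r ^ n)\<^sup>2) \<le> M * sqrt S"
    if "0 < r" "r < 1" for r :: real
  proof (rule field_le_epsilon)
    fix e :: real assume "0 < e"
    then show "sqrt (\<Sum>n<K. (cmod (c n))\<^sup>2 * (r ^ n)\<^sup>2) \<le> M * sqrt S + e"
      using approx[OF that, of "e / (M + 1)"] M(2) by simp
  qed
  have "((\<lambda>r. sqrt (\<Sum>n<K. (cmod (c n))\<^sup>2 * (r ^ n)\<^sup>2)) \<longlongrightarrow>
      sqrt (\<Sum>n<K. (cmod (c n))\<^sup>2 * (1 ^ n)\<^sup>2)) (at_left (1::real))"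
    by (intro tendsto_intros)
  moreover have "\<forall>\<^sub>F r in at_left (1::real).
      sqrt (\<Sum>n<K. (cmod (c n))\<^sup>2 * (r ^ n)\<^sup>2) \<le> M * sqrt S"
    using eventually_at_left_real[of 0 1] by (rule eventually_mono) (use bound_r in auto)
  ultimately have "sqrt (\<Sum>n<K. (cmod (c n))\<^sup>2 * (1 ^ n)\<^sup>2) \<le> M * sqrt S"
    by (rule tendsto_upperbound) simp
  then have "sqrt (\<Sum>n<K. (cmod (c n))\<^sup>2) \<le> sqrt (M\<^sup>2 * S)"
    using M(2) by (simp add: real_sqrt_mult)
  then show ?thesis by (simp add: a_def c_def S_def)
qed

text \<open>
  Outside \<open>Hinf\<close> the following two are not constrained; on \<open>Hinf\<close> see \<open>mult_operator_apply\<close> below.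
\<close>

definition mult_hardy :: "(complex \<Rightarrow> complex) \<Rightarrow> hardy \<Rightarrow> hardy" where
  "mult_hardy \<theta> f = Hardy (\<lambda>z. \<theta> z * hardy_apply f z)"

definition mult_operator :: "(complex \<Rightarrow> complex) \<Rightarrow> hardy operators" where
  "mult_operator \<theta> = CBlinfun (mult_hardy \<theta>)"

lemma mult_hardy_bounded:
  assumes \<theta>: "\<theta> holomorphic_on ball 0 1" "\<And>z. z \<in> ball 0 1 \<Longrightarrow> cmod (\<theta> z) \<le> M"
  shows mult_hardy_apply: "hardy_apply (mult_hardy \<theta> f) = (\<lambda>z. \<theta> z * hardy_apply f z)"
    and norm_mult_hardy_le: "norm (mult_hardy \<theta> f) \<le> norm f * M"
proof -
  let ?g = "\<lambda>z. \<theta> z * hardy_apply f z"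
  have M: "0 \<le> M" using \<theta>(2)[of 0] norm_ge_zero[of "\<theta> 0"] by (simp del: norm_ge_zero)
  have g: "?g holomorphic_on ball 0 1"
    by (intro holomorphic_intros \<theta> hardy_holomorphic)
  have le: "(\<Sum>n<K. (cmod (taylor_coeff ?g n))\<^sup>2) \<le> M\<^sup>2 * (norm f)\<^sup>2" for K
    unfolding norm_hardy_square hardy_coeff_def
    by (rule taylor_square_sum_mult_le[OF hardy_holomorphic g])
      (use hardy_summable[of f] in \<open>simp_all add: hardy_coeff_def norm_mult \<theta>(2) M mult_right_mono\<close>)
  have sm: "summable (\<lambda>n. (cmod (taylor_coeff ?g n))\<^sup>2)"
    by (rule summableI_nonneg_bounded[OF _ le]) simp
  show app: "hardy_apply (mult_hardy \<theta> f) = ?g"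
    unfolding mult_hardy_def
    by (rule Hardy_inverse) (use g sm hardy_outside in \<open>auto simp del: mem_ball\<close>)
  have "(norm (mult_hardy \<theta> f))\<^sup>2 \<le> (norm f * M)\<^sup>2"
    unfolding norm_hardy_square[of "mult_hardy \<theta> f"] hardy_coeff_def app
    using suminf_le_const[OF sm le] by (simp add: power_mult_distrib mult.commute)
  then show "norm (mult_hardy \<theta> f) \<le> norm f * M"
    using M by (simp add: power2_le_iff_abs_le)
qed

lemma mult_operator_apply:
  assumes "\<theta> \<in> Hinf"
  shows "hardy_apply (cblinfun_apply (mult_operator \<theta>) f) z = \<theta> z * hardy_apply f z"
proof -
  from assms obtain M where \<theta>: "\<theta> holomorphic_on ball 0 1"
      "\<And>z. z \<in> ball 0 1 \<Longrightarrow> cmod (\<theta> z) \<le> M"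
    unfolding Hinf_def bounded_iff by blast
  have app: "hardy_apply (mult_hardy \<theta> f) = (\<lambda>z. \<theta> z * hardy_apply f z)"
    and norm: "norm (mult_hardy \<theta> f) \<le> norm f * M" for f
    using mult_hardy_apply[of \<theta> M f] norm_mult_hardy_le[of \<theta> M f] \<theta> by blast+
  have "bounded_clinear (mult_hardy \<theta>)"
    by (rule bounded_clinearI[where K = M]; (rule norm hardy_eqI)?)
      (simp_all add: app plus_hardy.rep_eq scaleC_hardy_def scale_hardy.rep_eq algebra_simps)
  then show ?thesis by (simp add: mult_operator_def CBlinfun_inverse app)
qed

definition shift :: "hardy operators" where
  "shift = mult_operator (\<lambda>z. z)"

lemma shift_apply: "hardy_apply (cblinfun_apply shift f) z = z * hardy_apply f z"
  unfolding shift_def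
  by (rule mult_operator_apply) (auto simp: Hinf_def bounded_iff intro!: holomorphic_intros exI[of _ 1])

end

theory Submission
  imports Defs
begin

text \<open>
  The operator \<open>A = X(I)\<close> commutes with the shift \<open>S\<close>, and an operator commuting with \<open>S\<close>
  is multiplication by a bounded analytic function
  (\<open>shift_commutant_eq_mult_operator\<close>). Since \<open>X(S T) = S X(T)\<close>, induction
  gives \<open>X(S\<^sup>n) = S\<^sup>n A = A S\<^sup>n\<close>: on the powers of the shift, \<open>X\<close> is left multiplication
  by \<open>A\<close>. Both maps are bounded and linear, so they also agree on the closed linear span.

  To see that \<open>A\<close> is a multiplication operator, put \<open>\<theta> = A 1\<close>. Splitting off the constant term
  repeatedly, \<open>f = \<Sum>k<m. a\<^sub>k z\<^sup>k + z\<^sup>m f\<^sub>m\<close>, where the tail \<open>f\<^sub>m\<close> has norm at most that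
  of \<open>f\<close>. As \<open>A\<close> commutes with multiplication by \<open>z\<close>, this yields
  \<open>(A f)(z) = \<theta>(z) (\<Sum>k<m. a\<^sub>k z\<^sup>k) + z\<^sup>m (A f\<^sub>m)(z)\<close>. Point evaluations are bounded on
  the Hardy space, so \<open>(A f\<^sub>m)(z)\<close> stays bounded as \<open>m\<close> grows and the last term tends to \<open>0\<close>;
  hence \<open>(A f)(z) = \<theta>(z) f(z)\<close>.

  That \<open>\<theta>\<close> is bounded comes from iterating \<open>A\<close> on the constant function: \<open>\<theta>(z)\<^sup>n\<close> is the
  value at \<open>z\<close> of \<open>A\<^sup>n 1\<close>, so it grows no faster than a constant times the \<open>n\<close>-th power of the
  norm of \<open>A\<close>, and therefore \<open>\<theta>(z)\<close> is bounded by that norm.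
\<close>

section \<open>Power series with square-summable coefficients\<close>

definition hardy_series :: "(nat \<Rightarrow> complex) \<Rightarrow> hardy" where
  "hardy_series a = Hardy (\<lambda>z. if z \<in> ball 0 1 then \<Sum>n. a n * z ^ n else 0)"

text \<open>
  Elements of the Hardy space are given as functions; this converse of the Taylor expansion
  allows one to construct them from their coefficients.
\<close>

lemma taylor_coeff_unique:
  assumes sums: "\<And>z. z \<in> ball 0 1 \<Longrightarrow> (\<lambda>n. a n * z ^ n) sums f z"
  shows "f holomorphic_on ball 0 1" "taylor_coeff f n = a n"
proof -
  show "f holomorphic_on ball 0 1"
    by (rule power_series_holomorphic[where a = a]) (use sums in simp)
  have "summable (\<lambda>n. a n * (1 / 2) ^ n)"
    using sums[of "1 / 2"] by (simp add: sums_iff)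
  then have "ereal (norm (1 / 2 :: complex)) \<le> conv_radius a"
    by (rule conv_radius_geI)
  then have "0 < conv_radius a"
    by (rule less_le_trans[rotated]) simp
  moreover have "\<forall>\<^sub>F z in nhds 0. eval_fps (Abs_fps a) z = f z"
    using eventually_nhds_in_open[of "ball 0 1" "0::complex"]
    by (rule eventually_mono[rotated 2]) (use sums in \<open>auto simp: eval_fps_def sums_iff\<close>)
  ultimately have "f has_fps_expansion Abs_fps a"
    by (simp add: has_fps_expansion_def fps_conv_radius_def)
  then show "taylor_coeff f n = a n"
    unfolding taylor_coeff_def by (metis fps_nth_fps_expansion fps_nth_Abs_fps)
qed

lemma hardy_coeff_series:
  assumes "summable (\<lambda>n. (cmod (a n))\<^sup>2)"
  shows "hardy_coeff (hardy_series a) = a"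
proof -
  let ?f = "\<lambda>z::complex. if z \<in> ball 0 1 then \<Sum>n. a n * z ^ n else 0"
  \<comment> \<open>Square-summable coefficients are eventually bounded by \<open>1\<close>, so the series is dominated by a
      geometric one.\<close>
  have "(\<lambda>n. (cmod (a n))\<^sup>2) \<longlonglongrightarrow> 0"
    by (rule summable_LIMSEQ_zero[OF assms])
  then have "\<forall>\<^sub>F n in sequentially. (cmod (a n))\<^sup>2 < 1"
    by (rule order_tendstoD) simp
  then have ev: "\<forall>\<^sub>F n in sequentially. cmod (a n) \<le> 1"
    by (rule eventually_mono) (simp add: abs_square_less_1 less_imp_le)
  have sums: "(\<lambda>n. a n * z ^ n) sums ?f z" if z: "z \<in> ball 0 1" for z
  proof -
    have "summable (\<lambda>n. a n * z ^ n)"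
    proof (rule summable_comparison_test_ev)
      show "\<forall>\<^sub>F n in sequentially. norm (a n * z ^ n) \<le> cmod z ^ n"
        using ev by eventually_elim (simp add: norm_mult norm_power mult_left_le_one_le)
      show "summable (\<lambda>n. cmod z ^ n)" using z by (simp add: summable_geometric)
    qed
    then show ?thesis using z by (simp add: summable_sums)
  qed
  have "hardy_apply (hardy_series a) = ?f"
    unfolding hardy_series_def
    by (rule Hardy_inverse)
      (use assms taylor_coeff_unique[of a ?f, OF sums] in auto)
  then show ?thesis
    using taylor_coeff_unique(2)[of a ?f, OF sums] by (auto simp: hardy_coeff_def)
qed

lemma cmod_hardy_coeff_le: "cmod (hardy_coeff f n) \<le> norm f"
proof (rule power2_le_imp_le)
  show "(cmod (hardy_coeff f n))\<^sup>2 \<le> (norm f)\<^sup>2"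
    unfolding norm_hardy_square
    using sum_le_suminf[OF hardy_summable, of "{n}" f] by simp
qed simp

text \<open>
  Point evaluations are bounded: each coefficient is at most the norm, and the
  geometric series does the rest. The constant is not the optimal one \<open>1 / sqrt (1 - |z|\<^sup>2)\<close>, but
  only its independence of \<open>f\<close> matters below.
\<close>

lemma cmod_hardy_apply_le:
  assumes "z \<in> ball 0 1"
  shows "cmod (hardy_apply f z) \<le> norm f / (1 - cmod z)"
proof -
  have g: "(\<lambda>n. norm f * cmod z ^ n) sums (norm f * (1 / (1 - cmod z)))"
    by (intro sums_mult geometric_sums) (use assms in simp)
  have "cmod (\<Sum>n. hardy_coeff f n * z ^ n) \<le> (\<Sum>n. norm f * cmod z ^ n)"
    by (rule norm_suminf_le[OF _ sums_summable[OF g]])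
      (simp add: norm_mult norm_power mult_right_mono cmod_hardy_coeff_le)
  then show ?thesis
    using hardy_sums[OF assms, of f] sums_unique[OF g] by (simp add: sums_iff)
qed

section \<open>Constants and tails of power series\<close>

definition hardy_one :: hardy where
  "hardy_one = hardy_series (\<lambda>n. if n = 0 then 1 else 0)"

text \<open>
  This is the \<open>m\<close>-th iterate of the backward shift, the adjoint of the shift. Defining it through
  coefficients makes the norm bound uniform in \<open>m\<close> immediate.
\<close>

definition hardy_tail :: "hardy \<Rightarrow> nat \<Rightarrow> hardy" where
  "hardy_tail f m = hardy_series (\<lambda>n. hardy_coeff f (n + m))"

lemma hardy_one_apply:
  assumes "z \<in> ball 0 1"
  shows "hardy_apply hardy_one z = 1"
proof -
  have "summable (\<lambda>n. (cmod (if n = (0::nat) then 1 else 0))\<^sup>2)"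
    by (rule summable_finite[of "{0}"]) auto
  then have "hardy_coeff hardy_one = (\<lambda>n. if n = 0 then 1 else 0)"
    unfolding hardy_one_def by (rule hardy_coeff_series)
  then have "(\<lambda>n. (if n = 0 then 1 else 0) * z ^ n) sums hardy_apply hardy_one z"
    using hardy_sums[OF assms, of hardy_one] by simp
  moreover have "(\<lambda>n. (if n = 0 then 1 else 0) * z ^ n) sums 1"
  proof -
    have "(\<lambda>n. (if n = 0 then 1 else 0) * z ^ n) = (\<lambda>n. if n = 0 then z ^ n else 0)"
      by auto
    then show ?thesis using sums_single[of 0 "\<lambda>n. z ^ n"] by simp
  qed
  ultimately show ?thesis by (rule sums_unique2)
qed

lemma hardy_coeff_tail: "hardy_coeff (hardy_tail f m) n = hardy_coeff f (n + m)"
  unfolding hardy_tail_def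
  by (subst hardy_coeff_series)
    (rule summable_ignore_initial_segment[OF hardy_summable], rule refl)

lemma hardy_tail_0: "hardy_tail f 0 = f"
  by (rule hardy_eqI_coeff) (simp add: hardy_coeff_tail)

lemma norm_hardy_tail_le: "norm (hardy_tail f m) \<le> norm f"
proof (rule power2_le_imp_le)
  have "(\<Sum>n. (cmod (hardy_coeff f (n + m)))\<^sup>2) \<le> (\<Sum>n. (cmod (hardy_coeff f n))\<^sup>2)"
    by (subst suminf_split_initial_segment[OF hardy_summable, of f m])
      (simp add: sum_nonneg)
  then show "(norm (hardy_tail f m))\<^sup>2 \<le> (norm f)\<^sup>2"
    by (simp add: norm_hardy_square hardy_coeff_tail)
qed simp

lemma hardy_tail_split:
  "hardy_tail f m = hardy_coeff f m *\<^sub>C hardy_one + cblinfun_apply shift (hardy_tail f (Suc m))"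
proof (rule hardy_eqI)
  fix z :: complex assume z: "z \<in> ball 0 1"
  have "(\<lambda>n. hardy_coeff f (Suc n + m) * z ^ Suc n) sums
      (z * hardy_apply (hardy_tail f (Suc m)) z)"
    using sums_mult[OF hardy_sums[OF z, of "hardy_tail f (Suc m)"], of z]
    by (simp add: hardy_coeff_tail mult.left_commute)
  then have "(\<lambda>n. hardy_coeff f (n + m) * z ^ n) sums
      (z * hardy_apply (hardy_tail f (Suc m)) z + hardy_coeff f m)"
    by (subst (asm) sums_Suc_iff[where f = "\<lambda>n. hardy_coeff f (n + m) * z ^ n"]) simp
  moreover have "(\<lambda>n. hardy_coeff f (n + m) * z ^ n) sums hardy_apply (hardy_tail f m) z"
    using hardy_sums[OF z, of "hardy_tail f m"] by (simp add: hardy_coeff_tail)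
  ultimately have "hardy_apply (hardy_tail f m) z
      = z * hardy_apply (hardy_tail f (Suc m)) z + hardy_coeff f m"
    by (rule sums_unique2[symmetric])
  then show "hardy_apply (hardy_tail f m) z = hardy_apply
      (hardy_coeff f m *\<^sub>C hardy_one + cblinfun_apply shift (hardy_tail f (Suc m))) z"
    using hardy_one_apply[OF z]
    by (simp add: plus_hardy.rep_eq scaleC_hardy_def scale_hardy.rep_eq shift_apply)
qed

section \<open>The commutant of the shift\<close>

lemma norm_cblinfun_apply_le: "norm (cblinfun_apply A x) \<le> norm A * norm x"
  unfolding norm_cblinfun.rep_eq by (rule onorm[OF cblinfun_bounded_linear])

lemma cblinfun_add: "cblinfun_apply A (x + y) = cblinfun_apply A x + cblinfun_apply A y"
  using cblinfun_bounded_linear[of A] by (rule linear_simps)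

lemma commutant_apply:
  assumes "B \<in> commutant A"
  shows "cblinfun_apply A (cblinfun_apply B x) = cblinfun_apply B (cblinfun_apply A x)"
  using assms cblinfun_compose.rep_eq[of A B] cblinfun_compose.rep_eq[of B A]
  by (simp add: commutant_def fun_eq_iff)

text \<open>
  Applying \<open>A\<close> to the splitting of each tail into its constant term and the shift of the next tail
  gives a recursion for the values at \<open>z\<close>. Unrolled, it is the partial sum of the
  power series of \<open>f\<close> times \<open>(A 1)(z)\<close>, up to a remainder with the factor \<open>z\<^sup>m\<close>. The uniform
  bound on the tails makes the remainder vanish in the limit.
\<close>

lemma shift_commutant_apply:
  assumes A: "A \<in> commutant shift" and z: "z \<in> ball 0 1"
  shows "hardy_apply (cblinfun_apply A f) z
    = hardy_apply (cblinfun_apply A hardy_one) z * hardy_apply f z"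
proof -
  define \<theta> where "\<theta> = hardy_apply (cblinfun_apply A hardy_one) z"
  define R where "R m = hardy_apply (cblinfun_apply A (hardy_tail f m)) z" for m
  have step: "R m = \<theta> * hardy_coeff f m + z * R (Suc m)" for m
    unfolding R_def hardy_tail_split[of f m] cblinfun_add cblinfun_scaleC
      commutant_apply[OF A, symmetric]
    by (simp add: shift_apply plus_hardy.rep_eq scaleC_hardy_def scale_hardy.rep_eq \<theta>_def)
  have partial: "R 0 = \<theta> * (\<Sum>k<m. hardy_coeff f k * z ^ k) + z ^ m * R m" for m
  proof (induction m)
    case (Suc m)
    then show ?case unfolding step[of m] by (simp add: algebra_simps)
  qed simp
  have bound: "cmod (R m) \<le> norm A * norm f / (1 - cmod z)" for m
  proof -
    have "norm (cblinfun_apply A (hardy_tail f m)) \<le> norm A * norm f"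
      by (rule order_trans[OF norm_cblinfun_apply_le])
        (simp add: mult_left_mono norm_hardy_tail_le)
    then show ?thesis
      unfolding R_def using z
      by (intro order_trans[OF cmod_hardy_apply_le[OF z]] divide_right_mono) auto
  qed
  have "(\<lambda>m. z ^ m * R m) \<longlonglongrightarrow> 0"
  proof (rule Lim_null_comparison)
    show "\<forall>\<^sub>F m in sequentially. norm (z ^ m * R m)
        \<le> cmod z ^ m * (norm A * norm f / (1 - cmod z))"
      by (intro always_eventually allI)
        (simp only: norm_mult norm_power, intro mult_left_mono bound, simp)
    show "(\<lambda>m. cmod z ^ m * (norm A * norm f / (1 - cmod z))) \<longlonglongrightarrow> 0"
      by (intro tendsto_mult_left_zero LIMSEQ_realpow_zero) (use z in auto)
  qed
  moreover have "(\<lambda>m. \<Sum>k<m. hardy_coeff f k * z ^ k) \<longlonglongrightarrow> hardy_apply f z"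
    using hardy_sums[OF z] by (simp add: sums_def)
  ultimately have "(\<lambda>m. \<theta> * (\<Sum>k<m. hardy_coeff f k * z ^ k) + z ^ m * R m)
      \<longlonglongrightarrow> \<theta> * hardy_apply f z + 0"
    by (intro tendsto_intros)
  then have "R 0 = \<theta> * hardy_apply f z"
    unfolding partial[symmetric] by (simp add: LIMSEQ_const_iff)
  then show ?thesis by (simp add: R_def \<theta>_def hardy_tail_0)
qed

lemma le_of_power_le_mult_power:
  fixes x K C :: real
  assumes le: "\<And>n. x ^ n \<le> C * K ^ n" and "0 \<le> K"
  shows "x \<le> K"
proof (rule ccontr)
  assume "\<not> x \<le> K"
  then have x: "0 < x" "K < x" using \<open>0 \<le> K\<close> by auto
  have "(\<lambda>n. C * (K / x) ^ n) \<longlonglongrightarrow> C * 0"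
    using x \<open>0 \<le> K\<close> by (intro tendsto_intros LIMSEQ_realpow_zero) auto
  moreover have "1 \<le> C * (K / x) ^ n" for n
    using le[of n] x by (simp add: power_divide field_simps)
  ultimately have "1 \<le> C * 0"
    by (intro LIMSEQ_le_const) auto
  then show False by simp
qed

text \<open>
  A direct estimate of \<open>\<theta>(z) = (A 1)(z)\<close> would blow up as \<open>z\<close> approaches the unit circle, because
  the bound for point evaluation does. Powers of \<open>A\<close> remove this factor: it enters the bound for
  \<open>\<theta>(z)\<^sup>n\<close> only once.
\<close>

lemma cmod_multiplier_le:
  assumes mult: "\<And>f. hardy_apply (cblinfun_apply A f) z = \<theta> z * hardy_apply f z"
    and z: "z \<in> ball 0 1"
  shows "cmod (\<theta> z) \<le> norm A"
proof (rule le_of_power_le_mult_power)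
  fix n
  have "hardy_apply ((cblinfun_apply A ^^ n) hardy_one) z = \<theta> z ^ n"
    by (induction n) (simp_all add: mult hardy_one_apply[OF z])
  moreover have "norm ((cblinfun_apply A ^^ n) hardy_one) \<le> norm A ^ n * norm hardy_one"
  proof (induction n)
    case (Suc n)
    have "norm ((cblinfun_apply A ^^ Suc n) hardy_one)
        \<le> norm A * norm ((cblinfun_apply A ^^ n) hardy_one)"
      by (simp add: norm_cblinfun_apply_le)
    also have "\<dots> \<le> norm A * (norm A ^ n * norm hardy_one)"
      by (intro mult_left_mono Suc.IH) simp
    finally show ?case by (simp add: mult.assoc)
  qed simp
  then have "norm ((cblinfun_apply A ^^ n) hardy_one) / (1 - cmod z)
      \<le> norm A ^ n * norm hardy_one / (1 - cmod z)"
    by (rule divide_right_mono) (use z in simp)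
  ultimately have "cmod (\<theta> z) ^ n \<le> norm A ^ n * norm hardy_one / (1 - cmod z)"
    using cmod_hardy_apply_le[OF z, of "(cblinfun_apply A ^^ n) hardy_one"]
    by (simp add: norm_power)
  then show "cmod (\<theta> z) ^ n \<le> norm hardy_one / (1 - cmod z) * norm A ^ n"
    by (simp add: mult.commute)
qed simp

theorem shift_commutant_eq_mult_operator:
  assumes A: "A \<in> commutant shift"
  shows "\<exists>\<theta>\<in>Hinf. A = mult_operator \<theta>"
proof
  let ?\<theta> = "hardy_apply (cblinfun_apply A hardy_one)"
  have "cmod (?\<theta> z) \<le> norm A" if "z \<in> ball 0 1" for z
    using shift_commutant_apply[OF A that] that by (rule cmod_multiplier_le[where \<theta> = ?\<theta>])
  then have "bounded (?\<theta> ` ball 0 1)"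
    by (auto intro!: boundedI[where B = "norm A"])
  then show \<theta>: "?\<theta> \<in> Hinf"
    by (simp add: Hinf_def hardy_holomorphic)
  show "A = mult_operator ?\<theta>"
    by (intro cblinfun_eqI hardy_eqI)
      (simp only: mult_operator_apply[OF \<theta>], rule shift_commutant_apply[OF A])
qed

section \<open>Operators on the space of operators\<close>

text \<open>
  Commuting with left multiplication by \<open>A\<close> moves all factors \<open>A\<close> out of the argument on the left;
  the commutation of \<open>X(I)\<close> with \<open>A\<close> then moves them back to the right of \<open>X(I)\<close>.
\<close>

lemma apply_operator_power:
  assumes X: "X \<in> commutant (left_mult A)" and comm: "X id_operator \<in> commutant A"
  shows "cblinfun_apply X (operator_power A n) = X id_operator o\<^sub>C operator_power A n"
proof (induction n)
  case 0
  show ?case unfolding operator_power_def by (simp, rule cblinfun_eqI)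
      (simp add: cblinfun_compose.rep_eq id_operator.rep_eq)
next
  case (Suc n)
  have pow: "operator_power A (Suc n) = A o\<^sub>C operator_power A n"
    by (simp add: operator_power_def)
  have "cblinfun_apply X (A o\<^sub>C operator_power A n) = A o\<^sub>C cblinfun_apply X (operator_power A n)"
    using commutant_apply[OF X, of "operator_power A n"] by (simp add: left_mult_apply)
  also have "\<dots> = A o\<^sub>C (X id_operator o\<^sub>C operator_power A n)"
    by (simp only: Suc.IH)
  also have "\<dots> = X id_operator o\<^sub>C (A o\<^sub>C operator_power A n)"
    by (rule cblinfun_eqI) (simp add: cblinfun_compose.rep_eq commutant_apply[OF comm])
  finally show ?case by (simp only: pow)
qed

lemma cblinfun_eq_on_closure_cspan:
  assumes eq: "\<And>x. x \<in> G \<Longrightarrow> cblinfun_apply X x = cblinfun_apply Y x"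
    and x: "x \<in> closure (cspan G)"
  shows "cblinfun_apply X x = cblinfun_apply Y x"
proof -
  let ?E = "{x. cblinfun_apply X x = cblinfun_apply Y x}"
  have "cblinfun_apply X 0 = 0" "cblinfun_apply Y 0 = 0"
    by (rule linear_simps(3)[OF cblinfun_bounded_linear])+
  then have "complex_vector.subspace ?E"
    by (auto simp: complex_vector.subspace_def cblinfun_add cblinfun_scaleC)
  then have "cspan G \<subseteq> ?E"
    by (intro complex_vector.span_minimal) (use eq in auto)
  moreover have "closed ?E"
    by (intro closed_Collect_eq linear_continuous_on cblinfun_bounded_linear)
  ultimately show ?thesis
    using closure_minimal[of "cspan G" ?E] x by (simp add: subset_iff)
qed

theorem theorem2p8:
  fixes N :: "hardy operators set" and X :: "hardy operators operators"
  assumes "N = closure (cspan (range (\<lambda>n. operator_power shift n)))"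
    and "X \<in> commutant (left_mult shift)"
    and "X id_operator \<in> commutant shift"
  shows "\<exists>\<theta>\<in>Hinf. \<forall>T\<in>N. X T = left_mult (mult_operator \<theta>) T"
proof -
  obtain \<theta> where \<theta>: "\<theta> \<in> Hinf" "X id_operator = mult_operator \<theta>"
    using shift_commutant_eq_mult_operator[OF assms(3)] by blast
  have gen: "X T = left_mult (mult_operator \<theta>) T"
    if "T \<in> range (\<lambda>n. operator_power shift n)" for T
    using that apply_operator_power[OF assms(2,3)] by (auto simp: left_mult_apply \<theta>(2))
  have "\<forall>T\<in>N. X T = left_mult (mult_operator \<theta>) T"
    unfolding assms(1) using cblinfun_eq_on_closure_cspan[OF gen] by blast
  with \<theta>(1) show ?thesis by blast
qed

end
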